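(* Let $G$ be a group with no elements of order $2$, and let $A \subseteq G$ be a finite subset. Then $|AA^{-1}| - |A^{-1}A|$ is even.
   Context: For a finite subset $A$ of a group $G$, the right quotient set is $AA^{-1} = \{a b^{-1} : a, b \in A\}$ and the left quotient set is $A^{-1}A = \{a^{-1} b : a, b \in A\}$. *)

theory Defs
  imports "HOL-Algebra.Algebra"
begin

definition right_quotient_set :: "('a, 'b) monoid_scheme \<Rightarrow> 'a set \<Rightarrow> 'a set" where
  "right_quotient_set G A = {a \<otimes>\<^bsub>G\<^esub> inv\<^bsub>G\<^esub> b | a b. a \<in> A \<and> b \<in> A}"

definition left_quotient_set :: "('a, 'b) monoid_scheme \<Rightarrow> 'a set \<Rightarrow> 'a set" where
  "left_quotient_set G A = {inv\<^bsub>G\<^esub> a \<otimes>\<^bsub>G\<^esub> b | a b. a \<in> A \<and> b \<in> A}"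

end

(* Both quotient sets are closed under inversion.  Without elements of order 2 the only fixed point
   of inversion is the identity, which lies in both sets if A is nonempty; pairing the remaining
   elements with their inverses shows that both cardinalities are odd. *)

theory Submission
  imports Defs
begin

text \<open>Strong induction on the finite set: each orbit \<open>{x, f x}\<close> has exactly two
  elements, and deleting one preserves all the hypotheses on \<open>f\<close>.\<close>

lemma even_card_involution:
  assumes "finite S"
    and "\<And>x. x \<in> S \<Longrightarrow> f x \<in> S" "\<And>x. x \<in> S \<Longrightarrow> f (f x) = x" "\<And>x. x \<in> S \<Longrightarrow> f x \<noteq> x"
  shows "even (card S)"
  using assms
proof (induction S rule: finite_psubset_induct)
  case (psubset S)
  show ?case
  proof (cases "S = {}")
    case False
    then obtain x where x: "x \<in> S" by blast
    let ?P = "{x, f x}"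
    have P: "?P \<subseteq> S" "card ?P = 2"
      using x psubset.prems(1,3)[OF x] by auto
    have "even (card (S - ?P))"
    proof (rule psubset.IH)
      show "S - ?P \<subset> S" using x by blast
      \<comment> \<open>If \<open>f y\<close> were \<open>x\<close> or \<open>f x\<close>, applying
        \<open>f\<close> once more would give \<open>y = f x\<close> or \<open>y = x\<close>, so
        \<open>y\<close> would lie in the deleted orbit.\<close>
      show "f y \<in> S - ?P" if "y \<in> S - ?P" for y
        using that x psubset.prems(1,2) by (metis Diff_iff empty_iff insert_iff)
    qed (use psubset.prems in auto)
    moreover have "card S = card (S - ?P) + 2"
      using P psubset.hyps card_Diff_subset[of ?P S] card_mono[of S ?P] by simp
    ultimately show ?thesis by simp
  qed simp
qed

text \<open>A fixed point of inversion squares to the identity, so its order divides the prime 2; as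
  order 2 is excluded, the order is 1.\<close>

lemma (in group) inv_eq_self_iff:
  assumes "\<And>x. x \<in> carrier G \<Longrightarrow> ord x \<noteq> 2" and x: "x \<in> carrier G"
  shows "inv x = x \<longleftrightarrow> x = \<one>"
proof
  assume "inv x = x"
  then have "x \<otimes> x = \<one>" using r_inv[OF x] by simp
  then have "x [^] (2::nat) = \<one>" using x by (simp add: numeral_2_eq_2)
  then have "ord x dvd 2" using x pow_eq_id by blast
  then have "ord x = 1" using assms by (metis primes_dvd_imp_eq two_is_prime_nat prime_nat_iff)
  then show "x = \<one>" using x ord_eq_1 by blast
qed simp

lemma (in group) odd_card_inv_closed:
  assumes ord: "\<And>x. x \<in> carrier G \<Longrightarrow> ord x \<noteq> 2"
    and S: "finite S" "S \<subseteq> carrier G" "\<one> \<in> S" "\<And>x. x \<in> S \<Longrightarrow> inv x \<in> S"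
  shows "odd (card S)"
proof -
  have "even (card (S - {\<one>}))"
  proof (rule even_card_involution)
    show "inv x \<in> S - {\<one>}" "inv (inv x) = x" "inv x \<noteq> x" if "x \<in> S - {\<one>}" for x
      \<comment> \<open>Besides excluding fixed points, one must see that inversion never lands on
        the deleted identity: this is \<open>inv_eq_1_iff\<close>.\<close>
      using that S inv_eq_self_iff[OF ord, of x] inv_eq_1_iff[of x] by auto
  qed (use S in simp)
  moreover have "card S = Suc (card (S - {\<one>}))"
    using S by (metis card_Suc_Diff1)
  ultimately show ?thesis by simp
qed

lemma (in group) odd_card_right_quotient_set:
  assumes "\<And>x. x \<in> carrier G \<Longrightarrow> ord x \<noteq> 2" and A: "A \<subseteq> carrier G" "finite A" "A \<noteq> {}"
  shows "odd (card (right_quotient_set G A))"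
proof (rule odd_card_inv_closed)
  let ?Q = "right_quotient_set G A"
  have "?Q = (\<lambda>(a, b). a \<otimes> inv b) ` (A \<times> A)"
    unfolding right_quotient_set_def by auto
  then show "finite ?Q" using A by simp
  show "?Q \<subseteq> carrier G" using A unfolding right_quotient_set_def by auto
  \<comment> \<open>Nonemptiness of \<open>A\<close> enters here: any \<open>a\<close> in it yields
    the identity as \<open>a \<otimes> inv a\<close>.\<close>
  obtain a where "a \<in> A" using A by blast
  then show "\<one> \<in> ?Q" using A unfolding right_quotient_set_def by (force intro: r_inv[symmetric])
  show "inv x \<in> ?Q" if x: "x \<in> ?Q" for x
  proof -
    obtain a b where ab: "a \<in> A" "b \<in> A" "x = a \<otimes> inv b"
      using x unfolding right_quotient_set_def by blast
    then have "inv x = b \<otimes> inv a" using A by (simp add: inv_mult_group subset_iff)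
    then show ?thesis using ab unfolding right_quotient_set_def by blast
  qed
qed (use assms in simp)

text \<open>Writing \<open>b\<close> as \<open>inv (inv b)\<close> turns
  \<open>inv a \<otimes> b\<close> into a right quotient of inverses, so the parity argument is
  needed for right quotients only.\<close>

lemma (in group) left_quotient_set_eq_right_quotient_set:
  assumes "A \<subseteq> carrier G"
  shows "left_quotient_set G A = right_quotient_set G (m_inv G ` A)"
proof -
  have inv_inv_eq: "inv (inv b) = b" if "b \<in> A" for b
    using that assms by auto
  show ?thesis
  proof
    show "left_quotient_set G A \<subseteq> right_quotient_set G (m_inv G ` A)"
      unfolding left_quotient_set_def right_quotient_set_def using inv_inv_eq by force
    show "right_quotient_set G (m_inv G ` A) \<subseteq> left_quotient_set G A"
      unfolding left_quotient_set_def right_quotient_set_def using inv_inv_eq by fastforce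
  qed
qed

theorem theorem1p3:
  fixes G :: "('a, 'b) monoid_scheme" and A :: "'a set"
  assumes "group G"
    and "\<And>x. x \<in> carrier G \<Longrightarrow> group.ord G x \<noteq> 2"
    and "A \<subseteq> carrier G"
    and "finite A"
  shows "even (int (card (right_quotient_set G A)) - int (card (left_quotient_set G A)))"
proof (cases "A = {}")
  \<comment> \<open>The empty set is treated apart: both quotient sets are then empty, so their
    cardinalities are 0 rather than odd.\<close>
  case True
  then show ?thesis by (simp add: right_quotient_set_def left_quotient_set_def)
next
  case False
  interpret group G by fact
  have "odd (card (right_quotient_set G A))"
    using odd_card_right_quotient_set[OF assms(2-4) False] .
  moreover have "odd (card (left_quotient_set G A))"
    \<comment> \<open>The image of \<open>A\<close> under inversion is again a finite nonempty
      subset of the carrier.\<close>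
    unfolding left_quotient_set_eq_right_quotient_set[OF assms(3)]
    using assms(3,4) False by (intro odd_card_right_quotient_set assms(2)) auto
  ultimately show ?thesis by simp
qed

end
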